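(* The triple $(K[\mathcal{T}_\infty],*,\Delta)$, with unit $\odot$ and counit $\epsilon$, is a Hopf algebra; in particular $\Delta(u* v)=\Delta(u)*\Delta(v)$ for all trees $u,v$, where $*$ acts componentwise on $K[\mathcal{T}_\infty]\otimes K[\mathcal{T}_\infty]$.
   Context: $K$ is a field. A tree is a finite planar rooted tree; degree $|t|$ = number of non-root nodes; $\odot$ the one-node tree; $\mathcal{T}_\infty$ the set of trees; $K[\mathcal{T}_\infty]$ the vector space with basis $\mathcal{T}_\infty$, graded by degree. Nodes $N(t)$ are ordered by depth-first post-order (subtrees left to right recursively, then the node; root maximal); write $u_1<\dots<u_n$ for the non-root nodes. For a set $A$ of non-root nodes, $t_A$ is obtained by deleting non-root nodes outside $A$ (children of a deleted node attached in order to its parent in its place); $t_{[i,j]}=t_{\{u_h,\dots,u_k\}}$ if $i\le j$ and $[i,j]\cap[n]=[h,k]\ne\emptyset$, else $\odot$. Coproduct: $\Delta(t)=\sum_{k=0}^{n}t_{[1,k]}\otimes t_{[k+1,n]}$ for $|t|=n$; counit $\epsilon(t)=1$ if $|t|=0$, else $0$. A partition of $u$ of degree $n\ge1$ is an ordered tuple $(u_{[n_0+1,n_1]},\dots,u_{[n_{k-1}+1,n_k]})$ with $0=n_0<\dots<n_k=n$; $\mathcal{P}(u)$ the set of partitions. For $P=(u_1,\dots,u_k)$, $I(P,t)$ is the set of maps $f$ from blocks to $N(t)$ with $f(u_1)<\dots<f(u_k)$. The hash product $t\#_{P,f}u$ is obtained by identifying the root of each $u_i$ with $f(u_i)$, the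 root-children of $u_i$ becoming children of $f(u_i)$ to the right of its original children. The product $*$ is the bilinear extension of $t* u=\sum_{P\in\mathcal{P}(u)}\sum_{f\in I(P,t)}t\#_{P,f}u$ ($|u|\ge1$), $t*\odot=t$. *)

theory Defs
  imports Main "HOL-Library.Poly_Mapping"
begin

datatype tree = Node "tree list"

definition odot :: tree where "odot = Node []"

definition children :: "tree \<Rightarrow> tree list" where "children t = (case t of Node cs \<Rightarrow> cs)"

fun nnodes :: "tree \<Rightarrow> nat" and nnodes_list :: "tree list \<Rightarrow> nat" where
  "nnodes (Node cs) = Suc (nnodes_list cs)"
| "nnodes_list [] = 0"
| "nnodes_list (c # cs) = nnodes c + nnodes_list cs"

definition deg :: "tree \<Rightarrow> nat" where "deg t = nnodes t - 1"

text \<open>Nodes are identified with their position in the depth-first post-order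
  (subtrees left to right, then the node), numbered from 1; the root of t has
  number nnodes t = deg t + 1, and the non-root nodes u_1 < ... < u_n are 1..n.
  The second argument is an offset: the first node (in post-order) of the
  (sub)tree/forest being processed has number offset + 1.\<close>

fun restr_tree :: "nat set \<Rightarrow> nat \<Rightarrow> tree \<Rightarrow> tree list"
and restr_list :: "nat set \<Rightarrow> nat \<Rightarrow> tree list \<Rightarrow> tree list" where
  "restr_tree A off (Node cs) =
     (if off + nnodes (Node cs) \<in> A then [Node (restr_list A off cs)] else restr_list A off cs)"
| "restr_list A off [] = []"
| "restr_list A off (c # cs) = restr_tree A off c @ restr_list A (off + nnodes c) cs"

definition restr :: "tree \<Rightarrow> nat set \<Rightarrow> tree" where
  "restr t A = Node (restr_list A 0 (children t))"

text \<open>t_[i,j] (equals odot when the interval meets [1,n] in the empty set).\<close>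
definition restr_int :: "tree \<Rightarrow> nat \<Rightarrow> nat \<Rightarrow> tree" where
  "restr_int t i j = restr t ({i..j} \<inter> {1..deg t})"

fun graft_tree :: "(nat \<Rightarrow> tree list) \<Rightarrow> nat \<Rightarrow> tree \<Rightarrow> tree"
and graft_list :: "(nat \<Rightarrow> tree list) \<Rightarrow> nat \<Rightarrow> tree list \<Rightarrow> tree list" where
  "graft_tree g off (Node cs) = Node (graft_list g off cs @ g (off + nnodes (Node cs)))"
| "graft_list g off [] = []"
| "graft_list g off (c # cs) = graft_tree g off c # graft_list g (off + nnodes c) cs"

text \<open>A partition of u with deg u = n \<ge> 1 is encoded by its list of break points
  [n_1, ..., n_k] with 0 = n_0 < n_1 < ... < n_k = n.\<close>
definition partitions :: "nat \<Rightarrow> nat list set" where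
  "partitions n = {ns. ns \<noteq> [] \<and> sorted_wrt (<) ns \<and> set ns \<subseteq> {1..n} \<and> last ns = n}"

definition blocks :: "tree \<Rightarrow> nat list \<Rightarrow> tree list" where
  "blocks u ns = map (\<lambda>i. restr_int u ((0 # ns) ! i + 1) (ns ! i)) [0..<length ns]"

text \<open>I(P,t): strictly increasing maps from the k blocks to N(t) = {1..nnodes t},
  encoded as the list of images [f(u_1), ..., f(u_k)].\<close>
definition incr_maps :: "nat \<Rightarrow> tree \<Rightarrow> nat list set" where
  "incr_maps k t = {vs. length vs = k \<and> sorted_wrt (<) vs \<and> set vs \<subseteq> {1..nnodes t}}"

text \<open>t #_{P,f} u: the root of each block b_i is identified with node f(b_i);
  the root-children of b_i become the rightmost children of f(b_i).\<close>
definition hash :: "tree \<Rightarrow> tree list \<Rightarrow> nat list \<Rightarrow> tree" where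
  "hash t bs vs =
     graft_tree (\<lambda>v. concat (map (\<lambda>(b, w). if w = v then children b else []) (zip bs vs))) 0 t"

text \<open>K[X] (free K-vector space on the set X) is the type of finitely supported functions X =>0 K; the tensor product
  K[X] \<otimes> K[Y] is identified with K[X \<times> Y].\<close>

definition smult :: "'k::field \<Rightarrow> ('a \<Rightarrow>\<^sub>0 'k) \<Rightarrow> ('a \<Rightarrow>\<^sub>0 'k)" where
  "smult c v = Poly_Mapping.map (\<lambda>x. c * x) v"

definition basis :: "'a \<Rightarrow> ('a \<Rightarrow>\<^sub>0 'k::field)" where
  "basis a = Poly_Mapping.single a 1"

definition lin_ext :: "('a \<Rightarrow> ('b \<Rightarrow>\<^sub>0 'k::field)) \<Rightarrow> ('a \<Rightarrow>\<^sub>0 'k) \<Rightarrow> ('b \<Rightarrow>\<^sub>0 'k)" where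
  "lin_ext f v = (\<Sum>a\<in>Poly_Mapping.keys v. smult (Poly_Mapping.lookup v a) (f a))"

definition bil_ext :: "('a \<Rightarrow> 'b \<Rightarrow> ('c \<Rightarrow>\<^sub>0 'k::field)) \<Rightarrow> ('a \<Rightarrow>\<^sub>0 'k) \<Rightarrow> ('b \<Rightarrow>\<^sub>0 'k) \<Rightarrow> ('c \<Rightarrow>\<^sub>0 'k)" where
  "bil_ext f v w = (\<Sum>a\<in>Poly_Mapping.keys v. \<Sum>b\<in>Poly_Mapping.keys w. smult (Poly_Mapping.lookup v a * Poly_Mapping.lookup w b) (f a b))"

definition lin_fun :: "('a \<Rightarrow> 'k::field) \<Rightarrow> ('a \<Rightarrow>\<^sub>0 'k) \<Rightarrow> 'k" where
  "lin_fun e v = (\<Sum>a\<in>Poly_Mapping.keys v. Poly_Mapping.lookup v a * e a)"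

definition tensor :: "('a \<Rightarrow>\<^sub>0 'k::field) \<Rightarrow> ('b \<Rightarrow>\<^sub>0 'k) \<Rightarrow> ('a \<times> 'b \<Rightarrow>\<^sub>0 'k)" where
  "tensor v w = bil_ext (\<lambda>a b. basis (a, b)) v w"

definition tensor_map :: "('a \<Rightarrow> ('c \<Rightarrow>\<^sub>0 'k::field)) \<Rightarrow> ('b \<Rightarrow> ('d \<Rightarrow>\<^sub>0 'k)) \<Rightarrow>
    ('a \<times> 'b \<Rightarrow>\<^sub>0 'k) \<Rightarrow> ('c \<times> 'd \<Rightarrow>\<^sub>0 'k)" where
  "tensor_map f g = lin_ext (\<lambda>(a, b). tensor (f a) (g b))"

definition assoc_map :: "(('a \<times> 'b) \<times> 'c \<Rightarrow>\<^sub>0 'k::field) \<Rightarrow> ('a \<times> 'b \<times> 'c \<Rightarrow>\<^sub>0 'k)" where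
  "assoc_map = lin_ext (\<lambda>((a, b), c). basis (a, b, c))"

definition hopf_algebra ::
  "('a \<Rightarrow> 'a \<Rightarrow> ('a \<Rightarrow>\<^sub>0 'k::field)) \<Rightarrow> ('a \<Rightarrow>\<^sub>0 'k) \<Rightarrow> ('a \<Rightarrow> ('a \<times> 'a \<Rightarrow>\<^sub>0 'k)) \<Rightarrow> ('a \<Rightarrow> 'k) \<Rightarrow> bool"
where
  "hopf_algebra mb one db eb \<longleftrightarrow>
    (let m = bil_ext mb; \<Delta> = lin_ext db; \<epsilon> = lin_fun eb;
         m2 = bil_ext (\<lambda>(a, b) (c, d). tensor (mb a c) (mb b d)) in
      \<comment> \<open>unital associative algebra\<close>
      (\<forall>x y z. m (m x y) z = m x (m y z)) \<and>
      (\<forall>x. m one x = x \<and> m x one = x) \<and>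
      \<comment> \<open>counital coassociative coalgebra\<close>
      (\<forall>x. assoc_map (tensor_map db basis (\<Delta> x)) = tensor_map basis db (\<Delta> x)) \<and>
      (\<forall>x. lin_ext (\<lambda>(a, b). smult (eb a) (basis b)) (\<Delta> x) = x) \<and>
      (\<forall>x. lin_ext (\<lambda>(a, b). smult (eb b) (basis a)) (\<Delta> x) = x) \<and>
      \<comment> \<open>coproduct and counit are algebra morphisms\<close>
      (\<forall>x y. \<Delta> (m x y) = m2 (\<Delta> x) (\<Delta> y)) \<and>
      \<Delta> one = tensor one one \<and>
      (\<forall>x y. \<epsilon> (m x y) = \<epsilon> x * \<epsilon> y) \<and>
      \<epsilon> one = 1 \<and>
      \<comment> \<open>existence of an antipode (a linear map S, given on the basis by s)\<close>
      (\<exists>s. (\<forall>x. lin_ext (\<lambda>(a, b). m (s a) (basis b)) (\<Delta> x) = smult (\<epsilon> x) one) \<and>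
           (\<forall>x. lin_ext (\<lambda>(a, b). m (basis a) (s b)) (\<Delta> x) = smult (\<epsilon> x) one)))"

definition tree_prod :: "tree \<Rightarrow> tree \<Rightarrow> (tree \<Rightarrow>\<^sub>0 'k::field)" where
  "tree_prod t u =
     (if deg u = 0 then basis t
      else (\<Sum>ns\<in>partitions (deg u). \<Sum>vs\<in>incr_maps (length ns) t.
              basis (hash t (blocks u ns) vs)))"

definition tree_coprod :: "tree \<Rightarrow> (tree \<times> tree \<Rightarrow>\<^sub>0 'k::field)" where
  "tree_coprod t = (\<Sum>k\<in>{0..deg t}. basis (restr_int t 1 k, restr_int t (k + 1) (deg t)))"

definition tree_counit :: "tree \<Rightarrow> 'k::field" where
  "tree_counit t = (if deg t = 0 then 1 else 0)"

definition tprod :: "(tree \<Rightarrow>\<^sub>0 'k::field) \<Rightarrow> (tree \<Rightarrow>\<^sub>0 'k) \<Rightarrow> (tree \<Rightarrow>\<^sub>0 'k)" where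
  "tprod = bil_ext tree_prod"

definition tcoprod :: "(tree \<Rightarrow>\<^sub>0 'k::field) \<Rightarrow> (tree \<times> tree \<Rightarrow>\<^sub>0 'k)" where
  "tcoprod = lin_ext tree_coprod"

definition tprod2 :: "(tree \<times> tree \<Rightarrow>\<^sub>0 'k::field) \<Rightarrow> (tree \<times> tree \<Rightarrow>\<^sub>0 'k) \<Rightarrow> (tree \<times> tree \<Rightarrow>\<^sub>0 'k)" where
  "tprod2 = bil_ext (\<lambda>(a, b) (c, d). tensor (tree_prod a c) (tree_prod b d))"

end

theory Submission
  imports Defs "HOL-Library.Multiset"
begin

text \<open>
  Write a forest as $B(d) \cdot c$, where $B(d)$ is its first tree with children $d$. Reading the
  definitions in post-order gives, in Sweedler notation,
  $\Delta(B(d) c) = \sum d_1 \otimes B(d_2) c + \sum B(d) c_1 \otimes c_2$ and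
  $(B(d) c) * u = \sum B(d * u_1) (c * u_2)$, with $1 * u = u$. Coassociativity follows from the first
  recursion by induction, then compatibility of the product with $\Delta$ from both and
  coassociativity, and finally associativity from compatibility. The antipode exists since the
  bialgebra is graded and connected: the identity has a left and a right convolution inverse,
  defined by recursion on the degree, and these agree.
\<close>

text \<open>The structure constants are natural numbers, so associativity, coassociativity and
  compatibility are proved as identities of multisets and reach \<open>K\<close> only through
  \<open>msum\<close>. On forests they are stated for an arbitrary function \<open>\<phi>\<close>
  under the sum; this lets an induction hypothesis act inside nested sums. The obstacle is that the
  given definitions number all nodes of a tree and speak of intervals, break points and increasing
  maps, while the inductions need a recursion on forests. The bridges are
  \<open>forest_coprod_restr_list\<close> and \<open>sum_placements_graft\<close>. Both must allow
  arbitrary offsets and intervals, since the two parts of a forest see only a section of the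
  numbering. For the product, the root surrounding a forest comes right after the forest in
  post-order and counts as one additional slot. The root of the first tree then has the same role
  for its children \<open>d\<close> as the surrounding root has for the rest.\<close>

lemma sum_mset_swap_pair_pair:
  "(\<Sum>(a, b)\<in>#A. \<Sum>(c, d)\<in>#B. \<phi> a b c d) = (\<Sum>(c, d)\<in>#B. \<Sum>(a, b)\<in>#A. \<phi> a b c d)"
  using sum_mset.swap[of "\<lambda>p q. case p of (a, b) \<Rightarrow> case q of (c, d) \<Rightarrow> \<phi> a b c d" B A]
  by (simp add: case_prod_unfold)

lemma sum_mset_swap_pair:
  "(\<Sum>(a, b)\<in>#A. \<Sum>x\<in>#B. \<phi> a b x) = (\<Sum>x\<in>#B. \<Sum>(a, b)\<in>#A. \<phi> a b x)"
  using sum_mset.swap[of "\<lambda>p x. case p of (a, b) \<Rightarrow> \<phi> a b x" B A]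
  by (simp add: case_prod_unfold)

lemma sum_mset_pair_distrib:
  "(\<Sum>(a, b)\<in>#A. \<phi> a b + \<psi> a b) = (\<Sum>(a, b)\<in>#A. \<phi> a b) + (\<Sum>(a, b)\<in>#A. \<psi> a b)"
  by (simp add: case_prod_unfold sum_mset.distrib)

lemma sum_mset_sum_mset:
  "(\<Sum>x\<in>#(\<Sum>y\<in>#A. B y). \<phi> x) = (\<Sum>y\<in>#A. \<Sum>x\<in>#B y. \<phi> x)"
  by (induction A) auto

lemma sum_mset_sum_mset_pair:
  "(\<Sum>x\<in>#(\<Sum>(a, b)\<in>#A. B a b). \<phi> x) = (\<Sum>(a, b)\<in>#A. \<Sum>x\<in>#B a b. \<phi> x)"
  by (induction A) auto

subsection \<open>Free vector spaces\<close>

lemma lookup_smult [simp]: "Poly_Mapping.lookup (smult c v) k = c * Poly_Mapping.lookup v k"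
  by (simp add: smult_def Poly_Mapping.map.rep_eq when_def)

lemma smult_simps [simp]:
  "smult c (0 :: 'a \<Rightarrow>\<^sub>0 'k::field) = 0" "smult 0 v = (0 :: 'a \<Rightarrow>\<^sub>0 'k)" "smult 1 v = (v :: 'a \<Rightarrow>\<^sub>0 'k)"
  "smult c (smult d v) = smult (c * d) (v :: 'a \<Rightarrow>\<^sub>0 'k)"
  by (auto intro!: poly_mapping_eqI)

lemma smult_add_right: "smult c (v + w) = smult c v + smult c w"
  by (rule poly_mapping_eqI) (simp add: lookup_add algebra_simps)

lemma smult_add_left: "smult (c + d) v = smult c v + smult d v"
  by (rule poly_mapping_eqI) (simp add: lookup_add algebra_simps)

lemma smult_sum: "smult c (\<Sum>i\<in>I. f i) = (\<Sum>i\<in>I. smult c (f i))"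
  by (induction I rule: infinite_finite_induct) (auto simp: smult_add_right)

lemma lin_ext_superset:
  assumes "finite S" "Poly_Mapping.keys v \<subseteq> S"
  shows "lin_ext f v = (\<Sum>a\<in>S. smult (Poly_Mapping.lookup v a) (f a))"
  unfolding lin_ext_def by (rule sum.mono_neutral_left) (use assms in \<open>auto simp: in_keys_iff\<close>)

lemma lin_ext_0 [simp]: "lin_ext f 0 = 0"
  by (simp add: lin_ext_def)

lemma lin_ext_basis [simp]: "lin_ext f (basis a) = f a"
  by (simp add: lin_ext_def basis_def)

lemma lin_ext_add: "lin_ext f (v + w) = lin_ext f v + lin_ext f w"
proof -
  define S where "S = Poly_Mapping.keys v \<union> Poly_Mapping.keys w"
  have S: "finite S" "Poly_Mapping.keys v \<subseteq> S" "Poly_Mapping.keys w \<subseteq> S"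
      "Poly_Mapping.keys (v + w) \<subseteq> S"
    using Poly_Mapping.keys_add[of v w] by (auto simp: S_def)
  show ?thesis
    by (simp add: lin_ext_superset[OF S(1)] S(2-4) lookup_add smult_add_left sum.distrib)
qed

lemma lin_ext_smult: "lin_ext f (smult c v) = smult c (lin_ext f v)"
proof -
  have "Poly_Mapping.keys (smult c v) \<subseteq> Poly_Mapping.keys v"
    by (auto simp: in_keys_iff)
  then show ?thesis
    by (simp add: lin_ext_superset[of "Poly_Mapping.keys v"] smult_sum)
qed

lemma lin_ext_sum: "lin_ext f (\<Sum>i\<in>I. v i) = (\<Sum>i\<in>I. lin_ext f (v i))"
  by (induction I rule: infinite_finite_induct) (auto simp: lin_ext_add)

lemma lin_ext_sum_mset: "lin_ext f (\<Sum>i\<in>#I. v i) = (\<Sum>i\<in>#I. lin_ext f (v i))"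
  by (induction I) (auto simp: lin_ext_add)

lemma lin_ext_lin_ext: "lin_ext g (lin_ext f v) = lin_ext (\<lambda>a. lin_ext g (f a)) v"
  by (simp add: lin_ext_def[of f] lin_ext_def[of "\<lambda>a. lin_ext g (f a)"] lin_ext_sum lin_ext_smult)

lemma lin_ext_basis_right [simp]: "lin_ext basis v = v"
proof (rule poly_mapping_eqI)
  fix k
  have "Poly_Mapping.lookup (lin_ext basis v) k =
      (\<Sum>a\<in>Poly_Mapping.keys v. if a = k then Poly_Mapping.lookup v a else 0)"
    unfolding lin_ext_def lookup_sum
    by (rule sum.cong) (auto simp: basis_def lookup_single when_def)
  then show "Poly_Mapping.lookup (lin_ext basis v) k = Poly_Mapping.lookup v k"
    by (simp add: in_keys_iff)
qed

lemma lin_ext_0_fun [simp]: "lin_ext (\<lambda>_. 0) v = 0"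
  by (simp add: lin_ext_def)

lemma lin_ext_add_fun: "lin_ext (\<lambda>a. f a + g a) v = lin_ext f v + lin_ext g v"
  by (simp add: lin_ext_def smult_add_right sum.distrib)

lemma lin_ext_sum_mset_fun: "lin_ext (\<lambda>a. \<Sum>i\<in>#I. f i a) v = (\<Sum>i\<in>#I. lin_ext (f i) v)"
  by (induction I) (auto simp: lin_ext_add_fun)

lemma bil_ext_eq_lin_ext: "bil_ext f v w = lin_ext (\<lambda>a. lin_ext (f a) w) v"
  by (simp add: bil_ext_def lin_ext_def smult_sum)

text \<open>Turns a scalar-valued extension into a vector-valued one, so that the calculus of
  \<open>lin_ext\<close> also covers the counit.\<close>

lemma smult_lin_fun: "smult (lin_fun e v) w = lin_ext (\<lambda>a. smult (e a) w) v"
  by (rule poly_mapping_eqI) (simp add: lin_fun_def lin_ext_def lookup_sum sum_distrib_right)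

text \<open>Multiplicities become scalars, so in positive characteristic this is not injective:
  identities pass from multisets to vectors, not back.\<close>

definition msum :: "'a multiset \<Rightarrow> ('a \<Rightarrow>\<^sub>0 'k::field)" where
  "msum A = (\<Sum>a\<in>#A. basis a)"

lemma lin_ext_msum: "lin_ext f (msum A) = (\<Sum>a\<in>#A. f a)"
  by (simp add: msum_def lin_ext_sum_mset)

lemma msum_sum_mset: "msum (\<Sum>a\<in>#A. B a) = (\<Sum>a\<in>#A. msum (B a))"
  by (simp add: msum_def sum_mset_sum_mset)

lemma msum_singleton [simp]: "msum {#a#} = basis a"
  by (simp add: msum_def)

lemma tensor_msum: "tensor (msum A) (msum B) = (\<Sum>a\<in>#A. \<Sum>b\<in>#B. basis (a, b))"
  by (simp add: tensor_def bil_ext_eq_lin_ext lin_ext_msum)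

lemma tensor_msum_basis: "tensor (msum A) (basis b) = (\<Sum>a\<in>#A. basis (a, b))"
  using tensor_msum[of A "{#b#}"] by simp

lemma tensor_basis_msum: "tensor (basis a) (msum B) = (\<Sum>b\<in>#B. basis (a, b))"
  using tensor_msum[of "{#a#}" B] by simp

subsection \<open>Connected graded bialgebras with multiset structure constants\<close>

text \<open>Well-founded recursion on the weight: the right-hand side consults \<open>s\<close> only
  at elements of smaller weight. Leaving \<open>F\<close> arbitrary serves both the left and the
  right convolution inverse.\<close>

lemma ex_weight_recursion:
  fixes w :: "'a \<Rightarrow> nat" and e :: "'a \<Rightarrow> 'v::ab_group_add"
  assumes "\<And>x y z. (y, z) \<in># D x \<Longrightarrow> w y < w x"
  shows "\<exists>s. \<forall>x. s x = e x - (\<Sum>(y, z)\<in>#D x. F z (s y))"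
proof -
  define H where "H = (\<lambda>s x. e x - (\<Sum>(y, z)\<in>#D x. F z (s y)))"
  have "adm_wf (measure w) H"
    unfolding adm_wf_def H_def
    using assms by (auto intro!: arg_cong[where f = sum_mset] image_mset_cong)
  then have "wfrec (measure w) H = H (wfrec (measure w) H)"
    by (intro wfrec_fixpoint) auto
  then have "wfrec (measure w) H x = e x - (\<Sum>(y, z)\<in>#D x. F z (wfrec (measure w) H y))" for x
    unfolding H_def by metis
  then show ?thesis by blast
qed

text \<open>The counit is the indicator of \<open>e\<close>, so its axioms say that exactly one term
  of \<open>C x\<close> has \<open>e\<close> on a given side. The weight is the grading, and
  \<open>weight_0\<close> expresses connectedness.\<close>

locale multiset_bialgebra =
  fixes M :: "'a \<Rightarrow> 'a \<Rightarrow> 'a multiset" and C :: "'a \<Rightarrow> ('a \<times> 'a) multiset"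
    and e :: 'a and w :: "'a \<Rightarrow> nat"
  assumes assoc: "(\<Sum>x\<in>#M a b. M x c) = (\<Sum>y\<in>#M b c. M a y)"
    and unit_left: "M e a = {#a#}" and unit_right: "M a e = {#a#}"
    and coassoc: "(\<Sum>(a, b)\<in>#C x. image_mset (\<lambda>(a1, a2). (a1, a2, b)) (C a)) =
      (\<Sum>(a, b)\<in>#C x. image_mset (\<lambda>(b1, b2). (a, b1, b2)) (C b))"
    and counit_left: "filter_mset (\<lambda>p. fst p = e) (C x) = {#(e, x)#}"
    and counit_right: "filter_mset (\<lambda>p. snd p = e) (C x) = {#(x, e)#}"
    and compat: "(\<Sum>x\<in>#M a b. C x) =
      (\<Sum>(a1, a2)\<in>#C a. \<Sum>(b1, b2)\<in>#C b. \<Sum>x\<in>#M a1 b1. image_mset (Pair x) (M a2 b2))"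
    and coprod_unit: "C e = {#(e, e)#}"
    and weight_0: "w a = 0 \<longleftrightarrow> a = e"
    and weight_prod: "x \<in># M a b \<Longrightarrow> w x = w a + w b"
    and weight_coprod: "(a, b) \<in># C x \<Longrightarrow> w a + w b = w x"
begin

lemma sum_coassoc:
  "(\<Sum>(a, b)\<in>#C x. \<Sum>(a1, a2)\<in>#C a. \<phi> a1 a2 b) =
   (\<Sum>(a, b)\<in>#C x. \<Sum>(b1, b2)\<in>#C b. \<phi> a b1 b2)"
  using arg_cong[OF coassoc[of x], of "\<lambda>A. \<Sum>(a, b, c)\<in>#A. \<phi> a b c"]
  by (simp only: sum_mset_sum_mset_pair) (simp add: multiset.map_comp comp_def case_prod_unfold)

lemma sum_compat:
  "(\<Sum>x\<in>#M a b. \<Sum>p\<in>#C x. \<phi> p) =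
   (\<Sum>(a1, a2)\<in>#C a. \<Sum>(b1, b2)\<in>#C b. \<Sum>x\<in>#M a1 b1. \<Sum>y\<in>#M a2 b2. \<phi> (x, y))"
proof -
  have "(\<Sum>x\<in>#M a b. \<Sum>p\<in>#C x. \<phi> p) = (\<Sum>p\<in>#(\<Sum>x\<in>#M a b. C x). \<phi> p)"
    by (simp add: sum_mset_sum_mset)
  also have "\<dots> = (\<Sum>(a1, a2)\<in>#C a. \<Sum>p\<in>#(\<Sum>(b1, b2)\<in>#C b. \<Sum>x\<in>#M a1 b1. image_mset (Pair x) (M a2 b2)). \<phi> p)"
    unfolding compat by (simp only: sum_mset_sum_mset_pair)
  also have "\<dots> = (\<Sum>(a1, a2)\<in>#C a. \<Sum>(b1, b2)\<in>#C b. \<Sum>p\<in>#(\<Sum>x\<in>#M a1 b1. image_mset (Pair x) (M a2 b2)). \<phi> p)"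
    by (simp only: sum_mset_sum_mset_pair)
  finally show ?thesis
    by (simp only: sum_mset_sum_mset multiset.map_comp comp_def)
qed

lemma sum_counit_left: "(\<Sum>(a, b)\<in>#C x. if a = e then \<phi> b else 0) = \<phi> x"
proof -
  have "(\<Sum>(a, b)\<in>#A. if a = e then \<phi> b else 0) = (\<Sum>(a, b)\<in>#filter_mset (\<lambda>p. fst p = e) A. \<phi> b)" for A
    by (induction A) auto
  then show ?thesis by (simp add: counit_left)
qed

lemma sum_counit_right: "(\<Sum>(a, b)\<in>#C x. if b = e then \<phi> a else 0) = \<phi> x"
proof -
  have "(\<Sum>(a, b)\<in>#A. if b = e then \<phi> a else 0) = (\<Sum>(a, b)\<in>#filter_mset (\<lambda>p. snd p = e) A. \<phi> a)" for A
    by (induction A) auto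
  then show ?thesis by (simp add: counit_right)
qed

definition mul :: "('a \<Rightarrow>\<^sub>0 'k::field) \<Rightarrow> ('a \<Rightarrow>\<^sub>0 'k) \<Rightarrow> ('a \<Rightarrow>\<^sub>0 'k)" where
  "mul = bil_ext (\<lambda>a b. msum (M a b))"

lemma mul_eq: "mul x y = lin_ext (\<lambda>a. lin_ext (\<lambda>b. msum (M a b)) y) x"
  by (simp add: mul_def bil_ext_eq_lin_ext)

lemma mul_assoc: "mul (mul x y) z = mul x (mul y z)"
proof -
  have "mul (mul x y) z =
      lin_ext (\<lambda>a. lin_ext (\<lambda>b. lin_ext (\<lambda>c. msum (\<Sum>p\<in>#M a b. M p c)) z) y) x"
    by (simp add: mul_eq lin_ext_lin_ext lin_ext_msum lin_ext_sum_mset_fun msum_sum_mset)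
  also have "\<dots> = mul x (mul y z)"
    unfolding assoc by (simp add: mul_eq lin_ext_lin_ext lin_ext_msum msum_sum_mset)
  finally show ?thesis .
qed

lemma mul_unit [simp]: "mul (basis e) x = x" "mul x (basis e) = x"
  by (simp_all add: mul_eq unit_left unit_right)

lemma mul_0 [simp]: "mul 0 x = 0" "mul x 0 = 0"
  by (simp_all add: mul_eq)

lemma mul_sum_mset_left: "mul (\<Sum>i\<in>#I. f i) y = (\<Sum>i\<in>#I. mul (f i) y)"
  by (simp add: mul_eq lin_ext_sum_mset)

lemma mul_sum_mset_right: "mul x (\<Sum>i\<in>#I. f i) = (\<Sum>i\<in>#I. mul x (f i))"
  by (simp add: mul_eq lin_ext_sum_mset lin_ext_sum_mset_fun)

section \<open>Convolution and the antipode\<close>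

definition conv :: "('a \<Rightarrow> ('a \<Rightarrow>\<^sub>0 'k::field)) \<Rightarrow> ('a \<Rightarrow> ('a \<Rightarrow>\<^sub>0 'k)) \<Rightarrow> 'a \<Rightarrow> ('a \<Rightarrow>\<^sub>0 'k)" where
  "conv f g x = (\<Sum>(a, b)\<in>#C x. mul (f a) (g b))"

definition conv_unit :: "'a \<Rightarrow> ('a \<Rightarrow>\<^sub>0 'k::field)" where
  "conv_unit x = (if x = e then basis e else 0)"

lemma conv_assoc: "conv (conv f g) h = conv f (conv g h)"
proof
  fix x
  have "conv (conv f g) h x = (\<Sum>(a, b)\<in>#C x. \<Sum>(a1, a2)\<in>#C a. mul (mul (f a1) (g a2)) (h b))"
    by (simp add: conv_def mul_sum_mset_left case_prod_unfold)
  also have "\<dots> = (\<Sum>(a, b)\<in>#C x. \<Sum>(b1, b2)\<in>#C b. mul (mul (f a) (g b1)) (h b2))"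
    by (rule sum_coassoc)
  also have "\<dots> = conv f (conv g h) x"
    by (simp add: conv_def mul_sum_mset_right case_prod_unfold mul_assoc)
  finally show "conv (conv f g) h x = conv f (conv g h) x" .
qed

lemma conv_unit_left: "conv conv_unit f = f"
proof
  fix x
  have "conv conv_unit f x = (\<Sum>(a, b)\<in>#C x. if a = e then f b else 0)"
    unfolding conv_def conv_unit_def by (intro arg_cong[where f = sum_mset] image_mset_cong) auto
  then show "conv conv_unit f x = f x" by (simp add: sum_counit_left)
qed

lemma conv_unit_right: "conv f conv_unit = f"
proof
  fix x
  have "conv f conv_unit x = (\<Sum>(a, b)\<in>#C x. if b = e then f a else 0)"
    unfolding conv_def conv_unit_def by (intro arg_cong[where f = sum_mset] image_mset_cong) auto
  then show "conv f conv_unit x = f x" by (simp add: sum_counit_right)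
qed

lemma ex_antipode:
  "\<exists>s :: 'a \<Rightarrow> ('a \<Rightarrow>\<^sub>0 'k::field). conv s basis = conv_unit \<and> conv basis s = conv_unit"
proof -
  \<comment> \<open>This is \<open>conv l basis = conv_unit\<close> solved for the single term with
    second factor \<open>e\<close>; by \<open>counit_right\<close> that term is
    \<open>l x\<close>.\<close>
  have "\<exists>l :: 'a \<Rightarrow> ('a \<Rightarrow>\<^sub>0 'k). \<forall>x. l x = conv_unit x -
      (\<Sum>(a, b)\<in>#filter_mset (\<lambda>p. snd p \<noteq> e) (C x). mul (l a) (basis b))"
  proof (rule ex_weight_recursion[where w = w and F = "\<lambda>z v. mul v (basis z)"])
    show "w a < w x" if "(a, b) \<in># filter_mset (\<lambda>p. snd p \<noteq> e) (C x)" for x a b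
      using that weight_coprod[of a b x] weight_0[of b] by auto
  qed
  then obtain l :: "'a \<Rightarrow> ('a \<Rightarrow>\<^sub>0 'k)" where l: "\<And>x. l x = conv_unit x -
      (\<Sum>(a, b)\<in>#filter_mset (\<lambda>p. snd p \<noteq> e) (C x). mul (l a) (basis b))"
    by blast
  \<comment> \<open>The mirror image; \<open>prod.swap\<close> moves the argument of the recursive
    call to the first component, as \<open>ex_weight_recursion\<close> requires.\<close>
  have "\<exists>r :: 'a \<Rightarrow> ('a \<Rightarrow>\<^sub>0 'k). \<forall>x. r x = conv_unit x -
      (\<Sum>(b, a)\<in>#image_mset prod.swap (filter_mset (\<lambda>p. fst p \<noteq> e) (C x)). mul (basis a) (r b))"
  proof (rule ex_weight_recursion[where w = w and F = "\<lambda>z v. mul (basis z) v"])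
    show "w b < w x" if "(b, a) \<in># image_mset prod.swap (filter_mset (\<lambda>p. fst p \<noteq> e) (C x))" for x b a
      using that weight_coprod[of a b x] weight_0[of a] by auto
  qed
  then obtain r :: "'a \<Rightarrow> ('a \<Rightarrow>\<^sub>0 'k)" where r: "\<And>x. r x = conv_unit x -
      (\<Sum>(b, a)\<in>#image_mset prod.swap (filter_mset (\<lambda>p. fst p \<noteq> e) (C x)). mul (basis a) (r b))"
    by blast
  have left: "conv l basis = conv_unit"
  proof
    fix x
    have "conv l basis x = (\<Sum>(a, b)\<in>#filter_mset (\<lambda>p. snd p = e) (C x). mul (l a) (basis b)) +
        (\<Sum>(a, b)\<in>#filter_mset (\<lambda>p. snd p \<noteq> e) (C x). mul (l a) (basis b))"
      unfolding conv_def by (simp only: multiset_partition[symmetric] flip: sum_mset.union image_mset_union)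
    then show "conv l basis x = conv_unit x"
      using l[of x] by (simp add: counit_right)
  qed
  have right: "conv basis r = conv_unit"
  proof
    fix x
    have "conv basis r x = (\<Sum>(a, b)\<in>#filter_mset (\<lambda>p. fst p = e) (C x). mul (basis a) (r b)) +
        (\<Sum>(a, b)\<in>#filter_mset (\<lambda>p. fst p \<noteq> e) (C x). mul (basis a) (r b))"
      unfolding conv_def by (simp only: multiset_partition[symmetric] flip: sum_mset.union image_mset_union)
    then show "conv basis r x = conv_unit x"
      using r[of x] by (simp add: counit_left multiset.map_comp comp_def case_prod_unfold)
  qed
  have "l = r"
    using conv_assoc[of l basis r] by (simp add: left right conv_unit_left conv_unit_right)
  with left right show ?thesis by blast
qed

section \<open>The linearised bialgebra axioms\<close>

definition comul :: "('a \<Rightarrow>\<^sub>0 'k::field) \<Rightarrow> ('a \<times> 'a \<Rightarrow>\<^sub>0 'k)" where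
  "comul = lin_ext (\<lambda>a. msum (C a))"

lemma lin_ext_comul:
  "lin_ext f (comul x) = lin_ext (\<lambda>a. \<Sum>p\<in>#C a. f p) x"
  by (simp add: comul_def lin_ext_lin_ext lin_ext_msum)

lemma comul_coassoc:
  "assoc_map (tensor_map (\<lambda>a. msum (C a)) basis (comul x)) = tensor_map basis (\<lambda>a. msum (C a)) (comul x)"
proof -
  have "assoc_map (tensor_map (\<lambda>a. msum (C a)) basis (comul x)) =
    lin_ext (\<lambda>x. \<Sum>(a, b)\<in>#C x. \<Sum>(a1, a2)\<in>#C a. basis (a1, a2, b)) x"
    by (simp add: assoc_map_def tensor_map_def lin_ext_comul lin_ext_lin_ext tensor_msum_basis
        lin_ext_sum_mset case_prod_unfold)
  also have "\<dots> = tensor_map basis (\<lambda>a. msum (C a)) (comul x)"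
    unfolding sum_coassoc
    by (simp add: tensor_map_def lin_ext_comul tensor_basis_msum case_prod_unfold)
  finally show ?thesis .
qed

lemma comul_mul:
  "comul (mul x y) =
   bil_ext (\<lambda>(a, b) (c, d). tensor (msum (M a c)) (msum (M b d))) (comul x) (comul y)"
proof -
  have "comul (mul x y) = lin_ext (\<lambda>a. lin_ext (\<lambda>b. \<Sum>p\<in>#M a b. \<Sum>q\<in>#C p. basis q) y) x"
    by (simp add: comul_def mul_eq lin_ext_lin_ext lin_ext_msum) (simp add: msum_def)
  also have "\<dots> = bil_ext (\<lambda>(a, b) (c, d). tensor (msum (M a c)) (msum (M b d))) (comul x) (comul y)"
    unfolding sum_compat
    by (simp add: bil_ext_eq_lin_ext lin_ext_comul tensor_msum case_prod_unfold lin_ext_sum_mset_fun)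
  finally show ?thesis .
qed

lemma sum_smult_counit_left:
  "(\<Sum>(a, b)\<in>#C x. smult (if a = e then 1 else 0) (\<phi> b)) = \<phi> x"
proof -
  have "(\<Sum>(a, b)\<in>#C x. smult (if a = e then 1 else 0) (\<phi> b)) = (\<Sum>(a, b)\<in>#C x. if a = e then \<phi> b else 0)"
    by (intro arg_cong[where f = sum_mset] image_mset_cong) auto
  then show ?thesis by (simp add: sum_counit_left)
qed

lemma sum_smult_counit_right:
  "(\<Sum>(a, b)\<in>#C x. smult (if b = e then 1 else 0) (\<phi> a)) = \<phi> x"
proof -
  have "(\<Sum>(a, b)\<in>#C x. smult (if b = e then 1 else 0) (\<phi> a)) = (\<Sum>(a, b)\<in>#C x. if b = e then \<phi> a else 0)"
    by (intro arg_cong[where f = sum_mset] image_mset_cong) auto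
  then show ?thesis by (simp add: sum_counit_right)
qed

text \<open>Weights add under the product and only \<open>e\<close> has weight 0, so
  \<open>e\<close> occurs in \<open>M a b\<close> only if \<open>a = b = e\<close>.\<close>

lemma counit_mul:
  fixes x y :: "'a \<Rightarrow>\<^sub>0 'k::field"
  shows
  "lin_fun (\<lambda>a. if a = e then 1 else 0) (mul x y) =
   lin_fun (\<lambda>a. if a = e then 1 else 0) x * lin_fun (\<lambda>a. if a = e then 1 else 0) y"
proof -
  let ?\<epsilon> = "\<lambda>a. if a = e then 1 else 0"
  have prod: "(\<Sum>p\<in>#M a b. smult (?\<epsilon> p) v) = smult (?\<epsilon> a * ?\<epsilon> b) v" for a b and v :: "'a \<Rightarrow>\<^sub>0 'k"
  proof (cases "a = e \<and> b = e")
    case False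
    then have "p \<noteq> e" if "p \<in># M a b" for p
      using weight_prod[OF that] weight_0[of p] weight_0[of a] weight_0[of b] by auto
    then have "(\<Sum>p\<in>#M a b. smult (?\<epsilon> p) v) = (\<Sum>p\<in>#M a b. 0)"
      by (intro arg_cong[where f = sum_mset] image_mset_cong) auto
    with False show ?thesis by auto
  qed (simp add: unit_left)
  \<comment> \<open>Both scalars act on a vector, where \<open>smult_lin_fun\<close> applies; the
    scalar identity is recovered from the coefficient of \<open>e\<close> at
    \<open>v = basis e\<close>.\<close>
  have "smult (lin_fun ?\<epsilon> (mul x y)) v = smult (lin_fun ?\<epsilon> x * lin_fun ?\<epsilon> y) v" for v :: "'a \<Rightarrow>\<^sub>0 'k"
  proof -
    have "smult (lin_fun ?\<epsilon> (mul x y)) v = lin_ext (\<lambda>a. lin_ext (\<lambda>b. smult (?\<epsilon> a * ?\<epsilon> b) v) y) x"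
      unfolding smult_lin_fun mul_eq lin_ext_lin_ext lin_ext_msum prod ..
    also have "\<dots> = lin_ext (\<lambda>a. smult (?\<epsilon> a) (lin_ext (\<lambda>b. smult (?\<epsilon> b) v) y)) x"
      by (simp add: lin_ext_def smult_sum mult.left_commute)
    also have "\<dots> = smult (lin_fun ?\<epsilon> x * lin_fun ?\<epsilon> y) v"
      by (simp flip: smult_lin_fun) (simp add: lin_fun_def sum_distrib_right mult.assoc)
    finally show ?thesis .
  qed
  from arg_cong[OF this[of "basis e"], of "\<lambda>v. Poly_Mapping.lookup v e"] show ?thesis
    by (simp add: basis_def)
qed

theorem hopf_algebra_msum:
  "hopf_algebra (\<lambda>a b. msum (M a b) :: 'a \<Rightarrow>\<^sub>0 'k::field) (basis e) (\<lambda>a. msum (C a))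
     (\<lambda>a. if a = e then 1 else 0)"
proof -
  obtain s :: "'a \<Rightarrow> ('a \<Rightarrow>\<^sub>0 'k)" where s: "conv s basis = conv_unit" "conv basis s = conv_unit"
    using ex_antipode by blast
  have unit: "lin_ext conv_unit x = smult (lin_fun (\<lambda>a. if a = e then 1 else 0) x) (basis e :: 'a \<Rightarrow>\<^sub>0 'k)" for x
    unfolding smult_lin_fun
    by (rule arg_cong[where f = "\<lambda>f. lin_ext f x"]) (auto simp: conv_unit_def)
  have "lin_ext (\<lambda>(a, b). mul (s a) (basis b)) (comul x) = lin_ext conv_unit x" for x
    unfolding lin_ext_comul s(1)[symmetric] conv_def ..
  moreover have "lin_ext (\<lambda>(a, b). mul (basis a) (s b)) (comul x) = lin_ext conv_unit x" for x
    unfolding lin_ext_comul s(2)[symmetric] conv_def ..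
  ultimately have antipode: "\<exists>s :: 'a \<Rightarrow> ('a \<Rightarrow>\<^sub>0 'k).
    (\<forall>x. lin_ext (\<lambda>(a, b). mul (s a) (basis b)) (comul x) =
       smult (lin_fun (\<lambda>a. if a = e then 1 else 0) x) (basis e)) \<and>
    (\<forall>x. lin_ext (\<lambda>(a, b). mul (basis a) (s b)) (comul x) =
       smult (lin_fun (\<lambda>a. if a = e then 1 else 0) x) (basis e))"
    unfolding unit by blast
  have "comul (basis e :: 'a \<Rightarrow>\<^sub>0 'k) = tensor (basis e) (basis e)"
    using tensor_msum_basis[of "{#e#}" e, symmetric] by (simp add: comul_def coprod_unit)
  moreover have "lin_fun (\<lambda>a. if a = e then 1 else 0) (basis e :: 'a \<Rightarrow>\<^sub>0 'k) = 1"
    by (simp add: lin_fun_def basis_def)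
  ultimately show ?thesis
    unfolding hopf_algebra_def Let_def mul_def[symmetric] comul_def[symmetric]
    by (intro conjI allI antipode mul_assoc comul_coassoc comul_mul counit_mul)
      (simp_all add: lin_ext_comul sum_smult_counit_left sum_smult_counit_right)
qed

end

subsection \<open>Product and coproduct of forests\<close>

text \<open>The children of the root carry all the information, so trees are replaced by forests. The
  first summand cuts before the root of the first tree (whose children $d$ are cut), the second one after it.\<close>

fun forest_coprod :: "tree list \<Rightarrow> (tree list \<times> tree list) multiset" where
  "forest_coprod [] = {#([], [])#}"
| "forest_coprod (Node d # c) = image_mset (\<lambda>(d1, d2). (d1, Node d2 # c)) (forest_coprod d)
     + image_mset (\<lambda>(c1, c2). (Node d # c1, c2)) (forest_coprod c)"

text \<open>The nodes of the first tree precede those of $c$ in post-order, so the blocks attached to them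
  form an initial segment $u_1$ of $u$. In the base case, the slot of the surrounding root receives
  everything that is left.\<close>

fun forest_prod :: "tree list \<Rightarrow> tree list \<Rightarrow> tree list multiset" where
  "forest_prod [] u = {#u#}"
| "forest_prod (Node d # c) u =
     (\<Sum>(u1, u2)\<in>#forest_coprod u. \<Sum>x\<in>#forest_prod d u1. image_mset (\<lambda>y. Node x # y) (forest_prod c u2))"

text \<open>This form of the recursion, and its analogue for the product below, can rewrite deep
  inside nested sums, unlike the equation between multisets.\<close>

lemma sum_forest_coprod_Cons:
  "(\<Sum>(a, b)\<in>#forest_coprod (Node d # c). \<phi> a b) =
   (\<Sum>(d1, d2)\<in>#forest_coprod d. \<phi> d1 (Node d2 # c)) + (\<Sum>(c1, c2)\<in>#forest_coprod c. \<phi> (Node d # c1) c2)"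
  by (simp add: multiset.map_comp comp_def case_prod_unfold)

lemma sum_forest_prod_Cons:
  "(\<Sum>x\<in>#forest_prod (Node d # c) u. \<phi> x) =
   (\<Sum>(u1, u2)\<in>#forest_coprod u. \<Sum>x\<in>#forest_prod d u1. \<Sum>y\<in>#forest_prod c u2. \<phi> (Node x # y))"
  unfolding forest_prod.simps sum_mset_sum_mset_pair
  by (simp only: sum_mset_sum_mset multiset.map_comp comp_def)

lemma forest_coprod_coassoc:
  "(\<Sum>(a, b)\<in>#forest_coprod f. \<Sum>(a1, a2)\<in>#forest_coprod a. \<phi> a1 a2 b) =
   (\<Sum>(a, b)\<in>#forest_coprod f. \<Sum>(b1, b2)\<in>#forest_coprod b. \<phi> a b1 b2)"
proof (induction f arbitrary: \<phi> rule: forest_coprod.induct)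
  case (2 d c)
  show ?case
    \<comment> \<open>Besides the terms settled by the induction hypotheses, both sides contain the
      term with one cut in \<open>d\<close> and one in \<open>c\<close>, but with the two sums in
      opposite order; hence the swap.\<close>
    by (simp only: sum_forest_coprod_Cons sum_mset_pair_distrib 2 add.assoc
        sum_mset_swap_pair_pair[of "\<lambda>c1 c2 d1 d2. \<phi> d1 (Node d2 # c1) c2" "forest_coprod d" "forest_coprod c"])
qed simp

lemma forest_coprod_forest_prod:
  "(\<Sum>x\<in>#forest_prod f u. \<Sum>(x1, x2)\<in>#forest_coprod x. \<phi> x1 x2) =
   (\<Sum>(f1, f2)\<in>#forest_coprod f. \<Sum>(u1, u2)\<in>#forest_coprod u. \<Sum>x\<in>#forest_prod f1 u1. \<Sum>y\<in>#forest_prod f2 u2. \<phi> x y)"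
proof (induction f arbitrary: u \<phi> rule: forest_coprod.induct)
  case (2 d c)
  \<comment> \<open>Contribution of the cuts before the root of the first tree of the
    product.\<close>
  have "(\<Sum>(u1, u2)\<in>#forest_coprod u. \<Sum>x\<in>#forest_prod d u1. \<Sum>y\<in>#forest_prod c u2. \<Sum>(x1, x2)\<in>#forest_coprod x. \<phi> x1 (Node x2 # y)) =
    (\<Sum>(u1, u2)\<in>#forest_coprod u. \<Sum>y\<in>#forest_prod c u2. \<Sum>x\<in>#forest_prod d u1. \<Sum>(x1, x2)\<in>#forest_coprod x. \<phi> x1 (Node x2 # y))"
    by (subst sum_mset.swap) (rule refl)
  also have "\<dots> = (\<Sum>(u1, u2)\<in>#forest_coprod u. \<Sum>(d1, d2)\<in>#forest_coprod d. \<Sum>(v1, v2)\<in>#forest_coprod u1.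
      \<Sum>x\<in>#forest_prod d1 v1. \<Sum>z\<in>#forest_prod d2 v2. \<Sum>y\<in>#forest_prod c u2. \<phi> x (Node z # y))"
    by (simp only: 2(1) sum_mset_swap_pair[symmetric] sum_mset.swap[of _ "forest_prod c _"])
  also have "\<dots> = (\<Sum>(d1, d2)\<in>#forest_coprod d. \<Sum>(u1, u2)\<in>#forest_coprod u. \<Sum>(v1, v2)\<in>#forest_coprod u1.
      \<Sum>x\<in>#forest_prod d1 v1. \<Sum>z\<in>#forest_prod d2 v2. \<Sum>y\<in>#forest_prod c u2. \<phi> x (Node z # y))"
    by (rule sum_mset_swap_pair_pair)
  \<comment> \<open>Here \<open>u\<close> is cut into three pieces, for \<open>d1\<close>,
    \<open>d2\<close> and \<open>c\<close>. Coassociativity groups the last two together, which is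
    the product of \<open>Node d2 # c\<close> with one piece.\<close>
  also have "\<dots> = (\<Sum>(d1, d2)\<in>#forest_coprod d. \<Sum>(u1, u2)\<in>#forest_coprod u. \<Sum>(v1, v2)\<in>#forest_coprod u2.
      \<Sum>x\<in>#forest_prod d1 u1. \<Sum>z\<in>#forest_prod d2 v1. \<Sum>y\<in>#forest_prod c v2. \<phi> x (Node z # y))"
    by (simp only: forest_coprod_coassoc)
  also have "\<dots> = (\<Sum>(d1, d2)\<in>#forest_coprod d. \<Sum>(u1, u2)\<in>#forest_coprod u. \<Sum>x\<in>#forest_prod d1 u1.
      \<Sum>y\<in>#forest_prod (Node d2 # c) u2. \<phi> x y)"
    by (simp only: sum_forest_prod_Cons sum_mset_swap_pair)
  finally have left: "(\<Sum>(u1, u2)\<in>#forest_coprod u. \<Sum>x\<in>#forest_prod d u1. \<Sum>y\<in>#forest_prod c u2.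
      \<Sum>(x1, x2)\<in>#forest_coprod x. \<phi> x1 (Node x2 # y)) = \<dots>" .
  \<comment> \<open>Contribution of the cuts after that root; now the pieces for \<open>d\<close>
    and \<open>c1\<close> are the ones that belong together.\<close>
  have "(\<Sum>(u1, u2)\<in>#forest_coprod u. \<Sum>x\<in>#forest_prod d u1. \<Sum>y\<in>#forest_prod c u2. \<Sum>(y1, y2)\<in>#forest_coprod y. \<phi> (Node x # y1) y2) =
    (\<Sum>(u1, u2)\<in>#forest_coprod u. \<Sum>(c1, c2)\<in>#forest_coprod c. \<Sum>(v1, v2)\<in>#forest_coprod u2.
      \<Sum>x\<in>#forest_prod d u1. \<Sum>y\<in>#forest_prod c1 v1. \<Sum>z\<in>#forest_prod c2 v2. \<phi> (Node x # y) z)"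
    by (simp only: 2(2) sum_mset_swap_pair)
  also have "\<dots> = (\<Sum>(c1, c2)\<in>#forest_coprod c. \<Sum>(u1, u2)\<in>#forest_coprod u. \<Sum>(v1, v2)\<in>#forest_coprod u2.
      \<Sum>x\<in>#forest_prod d u1. \<Sum>y\<in>#forest_prod c1 v1. \<Sum>z\<in>#forest_prod c2 v2. \<phi> (Node x # y) z)"
    by (rule sum_mset_swap_pair_pair)
  also have "\<dots> = (\<Sum>(c1, c2)\<in>#forest_coprod c. \<Sum>(u1, u2)\<in>#forest_coprod u. \<Sum>x\<in>#forest_prod (Node d # c1) u1.
      \<Sum>y\<in>#forest_prod c2 u2. \<phi> x y)"
    by (simp only: sum_forest_prod_Cons forest_coprod_coassoc)
  finally have right: "(\<Sum>(u1, u2)\<in>#forest_coprod u. \<Sum>x\<in>#forest_prod d u1. \<Sum>y\<in>#forest_prod c u2.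
      \<Sum>(y1, y2)\<in>#forest_coprod y. \<phi> (Node x # y1) y2) = \<dots>" .
  show ?case
    by (simp only: sum_forest_prod_Cons[of _ d c u] sum_forest_coprod_Cons sum_mset.distrib sum_mset_pair_distrib left right)
qed simp

lemma forest_prod_assoc:
  "(\<Sum>x\<in>#forest_prod f u. \<Sum>y\<in>#forest_prod x v. \<phi> y) = (\<Sum>x\<in>#forest_prod u v. \<Sum>y\<in>#forest_prod f x. \<phi> y)"
proof (induction f arbitrary: u v \<phi> rule: forest_coprod.induct)
  case (2 d c)
  have "(\<Sum>x\<in>#forest_prod (Node d # c) u. \<Sum>y\<in>#forest_prod x v. \<phi> y) =
    (\<Sum>(u1, u2)\<in>#forest_coprod u. \<Sum>(v1, v2)\<in>#forest_coprod v. \<Sum>x\<in>#forest_prod d u1. \<Sum>x'\<in>#forest_prod x v1.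
      \<Sum>y\<in>#forest_prod c u2. \<Sum>y'\<in>#forest_prod y v2. \<phi> (Node x' # y'))"
    by (simp only: sum_forest_prod_Cons sum_mset_swap_pair sum_mset.swap[of _ "forest_prod c _"])
  also have "\<dots> = (\<Sum>(u1, u2)\<in>#forest_coprod u. \<Sum>(v1, v2)\<in>#forest_coprod v. \<Sum>z\<in>#forest_prod u1 v1. \<Sum>w\<in>#forest_prod u2 v2.
      \<Sum>x\<in>#forest_prod d z. \<Sum>y\<in>#forest_prod c w. \<phi> (Node x # y))"
    by (simp only: 2 sum_mset.swap[of _ "forest_prod _ _" "forest_prod d _"])
  \<comment> \<open>Compatibility is what makes the induction close: the products of the halves of
    \<open>u\<close> and \<open>v\<close> are exactly the cuts of the products of \<open>u\<close>
    and \<open>v\<close>.\<close>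
  also have "\<dots> = (\<Sum>x\<in>#forest_prod u v. \<Sum>y\<in>#forest_prod (Node d # c) x. \<phi> y)"
    by (simp only: sum_forest_prod_Cons forest_coprod_forest_prod)
  finally show ?case .
qed simp

lemma forest_coprod_counit_left: "filter_mset (\<lambda>p. fst p = []) (forest_coprod f) = {#([], f)#}"
proof (induction f rule: forest_coprod.induct)
  case (2 d c)
  have "filter_mset (\<lambda>p. fst p = []) (image_mset (\<lambda>(d1, d2). (d1, Node d2 # c)) (forest_coprod d)) =
      image_mset (\<lambda>(d1, d2). (d1, Node d2 # c)) (filter_mset (\<lambda>p. fst p = []) (forest_coprod d))"
    by (simp add: filter_mset_image_mset case_prod_unfold)
  with 2 show ?case by (simp add: filter_mset_image_mset case_prod_unfold)
qed simp

lemma forest_coprod_counit_right: "filter_mset (\<lambda>p. snd p = []) (forest_coprod f) = {#(f, [])#}"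
proof (induction f rule: forest_coprod.induct)
  case (2 d c)
  have "filter_mset (\<lambda>p. snd p = []) (image_mset (\<lambda>(c1, c2). (Node d # c1, c2)) (forest_coprod c)) =
      image_mset (\<lambda>(c1, c2). (Node d # c1, c2)) (filter_mset (\<lambda>p. snd p = []) (forest_coprod c))"
    by (simp add: filter_mset_image_mset case_prod_unfold)
  with 2 show ?case by (simp add: filter_mset_image_mset case_prod_unfold)
qed simp

lemma forest_prod_Nil: "forest_prod f [] = {#f#}"
  by (induction f rule: forest_coprod.induct) auto

lemma nnodes_list_forest_coprod: "(a, b) \<in># forest_coprod f \<Longrightarrow> nnodes_list a + nnodes_list b = nnodes_list f"
  by (induction f arbitrary: a b rule: forest_coprod.induct) fastforce+

lemma in_sum_mset_iff: "x \<in># (\<Sum>y\<in>#A. B y) \<longleftrightarrow> (\<exists>y\<in>#A. x \<in># B y)"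
  by (induction A) auto

lemma nnodes_list_forest_prod: "x \<in># forest_prod f u \<Longrightarrow> nnodes_list x = nnodes_list f + nnodes_list u"
proof (induction f arbitrary: x u rule: forest_coprod.induct)
  case (2 d c)
  from "2.prems" obtain u1 u2 y z where
    "(u1, u2) \<in># forest_coprod u" "y \<in># forest_prod d u1" "z \<in># forest_prod c u2" "x = Node y # z"
    by (auto simp: in_sum_mset_iff)
  with 2(1)[of y u1] 2(2)[of z u2] nnodes_list_forest_coprod[of u1 u2 u] show ?case by simp
qed simp

subsection \<open>Restriction to intervals\<close>

lemma restr_list_Cons:
  "restr_list A off (Node d # c) =
   (if off + Suc (nnodes_list d) \<in> A then [Node (restr_list A off d)] else restr_list A off d)
   @ restr_list A (off + Suc (nnodes_list d)) c"
  by simp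

text \<open>Lets an interval be truncated to the numbers that the forest really carries.\<close>

lemma restr_list_cong:
  assumes "\<And>i. off < i \<Longrightarrow> i \<le> off + nnodes_list f \<Longrightarrow> i \<in> A \<longleftrightarrow> i \<in> B"
  shows "restr_list A off f = restr_list B off f"
  using assms
proof (induction f arbitrary: off rule: forest_coprod.induct)
  case (2 d c)
  have "restr_list A off d = restr_list B off d"
    by (rule 2(1)) (use 2(3) in auto)
  moreover have "restr_list A (off + Suc (nnodes_list d)) c = restr_list B (off + Suc (nnodes_list d)) c"
    by (rule 2(2)) (use 2(3) in auto)
  ultimately show ?case
    using 2(3)[of "off + Suc (nnodes_list d)"] by (simp only: restr_list_Cons) simp
qed simp

lemma restr_list_empty: "restr_list {} off f = []"
  by (induction f arbitrary: off rule: forest_coprod.induct) auto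

lemma restr_list_UNIV: "restr_list UNIV off f = f"
  by (induction f arbitrary: off rule: forest_coprod.induct) auto

lemma restr_list_outside:
  assumes "\<And>i. off < i \<Longrightarrow> i \<le> off + nnodes_list f \<Longrightarrow> i \<notin> A"
  shows "restr_list A off f = []"
  using restr_list_cong[of off f A "{}"] assms by (simp add: restr_list_empty)

lemma mset_set_atLeastAtMost_split:
  fixes a b e :: nat
  assumes "a < e" "e \<le> b"
  shows "mset_set {a..b} = mset_set {a..e - 1} + mset_set {e..b}"
proof -
  have "{a..b} = {a..e - 1} \<union> {e..b}" using assms by auto
  then show ?thesis using assms by (subst mset_set_Union[symmetric]) auto
qed

text \<open>The recursive coproduct lists the cuts of an interval. The interval is general because
  the blocks of a partition are cut out of pieces that are themselves restrictions.\<close>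

lemma forest_coprod_restr_list:
  assumes "off \<le> a" "a \<le> b" "b \<le> off + nnodes_list f"
  shows "forest_coprod (restr_list {a<..b} off f) =
    image_mset (\<lambda>k. (restr_list {a<..k} off f, restr_list {k<..b} off f)) (mset_set {a..b})"
  using assms
proof (induction f arbitrary: off a b rule: forest_coprod.induct)
  case (1 off a b)
  then have "a = b" by simp
  then show ?case by simp
next
  case (2 d c)
  \<comment> \<open>The number of the root of the first tree. It survives exactly if
    \<open>a < e \<le> b\<close>; otherwise the interval meets only \<open>d\<close> or only
    \<open>c\<close>, and one induction hypothesis suffices.\<close>
  define e where "e = off + Suc (nnodes_list d)"
  have Cons: "restr_list A off (Node d # c) =
      (if e \<in> A then [Node (restr_list A off d)] else restr_list A off d) @ restr_list A e c" for A
    by (simp add: e_def)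
  consider "b < e" | "e \<le> a" | "a < e" "e \<le> b" by linarith
  then show ?case
  proof cases
    case 1
    then have "restr_list {i<..j} off (Node d # c) = restr_list {i<..j} off d" if "j \<le> b" for i j
      using that unfolding Cons by (simp add: restr_list_outside)
    moreover have "forest_coprod (restr_list {a<..b} off d) =
        image_mset (\<lambda>k. (restr_list {a<..k} off d, restr_list {k<..b} off d)) (mset_set {a..b})"
      by (rule 2(1)) (use 2(3-) 1 in \<open>auto simp: e_def\<close>)
    ultimately show ?thesis by (auto intro!: image_mset_cong)
  next
    case 2
    then have "restr_list {i<..j} off (Node d # c) = restr_list {i<..j} e c" if "a \<le> i" for i j
      using that unfolding Cons by (auto simp: e_def intro!: restr_list_outside)
    moreover have "forest_coprod (restr_list {a<..b} e c) =
        image_mset (\<lambda>k. (restr_list {a<..k} e c, restr_list {k<..b} e c)) (mset_set {a..b})"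
      by (rule "2.IH"(2)) (use "2.prems" 2 in \<open>auto simp: e_def\<close>)
    ultimately show ?thesis by (auto intro!: image_mset_cong)
  next
    case 3
    have hi: "restr_list {i<..j} off (Node d # c) =
        Node (restr_list {i<..e - 1} off d) # restr_list {e<..j} e c" if "i < e" "e \<le> j" for i j
    proof -
      have "restr_list {i<..j} off d = restr_list {i<..e - 1} off d"
        by (rule restr_list_cong) (use that in \<open>auto simp: e_def\<close>)
      moreover have "restr_list {i<..j} e c = restr_list {e<..j} e c"
        by (rule restr_list_cong) (use that in auto)
      ultimately show ?thesis using that unfolding Cons by simp
    qed
    have lo: "restr_list {i<..j} off (Node d # c) = restr_list {i<..j} off d" if "j < e" for i j
      using that unfolding Cons by (simp add: restr_list_outside)
    have up: "restr_list {i<..j} off (Node d # c) = restr_list {i<..j} e c" if "e \<le> i" for i j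
      using that unfolding Cons by (auto simp: e_def intro!: restr_list_outside)
    have d: "forest_coprod (restr_list {a<..e - 1} off d) =
        image_mset (\<lambda>k. (restr_list {a<..k} off d, restr_list {k<..e - 1} off d)) (mset_set {a..e - 1})"
      by (rule "2.IH"(1)) (use "2.prems" 3 in \<open>auto simp: e_def\<close>)
    have c: "forest_coprod (restr_list {e<..b} e c) =
        image_mset (\<lambda>k. (restr_list {e<..k} e c, restr_list {k<..b} e c)) (mset_set {e..b})"
      by (rule "2.IH"(2)) (use "2.prems" 3 in \<open>auto simp: e_def\<close>)
    \<comment> \<open>Cuts with \<open>k \<le> e - 1\<close> send the root to the right and give the
      first summand of \<open>forest_coprod\<close>; those with \<open>k \<ge> e\<close> keep it on
      the left and give the second.\<close>
    have "image_mset (\<lambda>k. (restr_list {a<..k} off (Node d # c), restr_list {k<..b} off (Node d # c)))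
        (mset_set {a..e - 1}) =
      image_mset (\<lambda>k. (restr_list {a<..k} off d,
        Node (restr_list {k<..e - 1} off d) # restr_list {e<..b} e c)) (mset_set {a..e - 1})"
    proof (intro image_mset_cong)
      fix k assume "k \<in># mset_set {a..e - 1}"
      then have "k < e" using 3 by auto
      then show "(restr_list {a<..k} off (Node d # c), restr_list {k<..b} off (Node d # c)) =
          (restr_list {a<..k} off d, Node (restr_list {k<..e - 1} off d) # restr_list {e<..b} e c)"
        using 3 by (simp only: hi lo)
    qed
    moreover have "image_mset (\<lambda>k. (restr_list {a<..k} off (Node d # c), restr_list {k<..b} off (Node d # c)))
        (mset_set {e..b}) =
      image_mset (\<lambda>k. (Node (restr_list {a<..e - 1} off d) # restr_list {e<..k} e c,
        restr_list {k<..b} e c)) (mset_set {e..b})"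
      using 3 by (intro image_mset_cong) (simp add: hi up del: restr_list.simps)
    ultimately show ?thesis
      unfolding mset_set_atLeastAtMost_split[OF 3] hi[OF 3] forest_coprod.simps d c
      by (simp add: multiset.map_comp comp_def del: restr_list.simps)
  qed
qed

lemma restr_list_all: "restr_list {0<..nnodes_list f} 0 f = f"
  using restr_list_cong[of 0 f "{0<..nnodes_list f}" UNIV] by (simp add: restr_list_UNIV)

lemma nnodes_eq: "nnodes t = Suc (nnodes_list (children t))"
  by (cases t) (simp add: children_def)

lemma deg_eq: "deg t = nnodes_list (children t)"
  by (simp add: deg_def nnodes_eq)

text \<open>With half-open intervals consecutive blocks share an endpoint, which absorbs the
  \<open>+ 1\<close> in the definition of blocks.\<close>

lemma restr_int_eq: "restr_int t (Suc i) j = Node (restr_list {i<..j} 0 (children t))"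
  unfolding restr_int_def restr_def
  by (auto simp: deg_eq intro!: restr_list_cong)

subsection \<open>The hash product\<close>

text \<open>A list of pairs $(v, m)$ means that a block ending at node $m$ of the right factor is attached
  to node $v$ of the left one; the first block starts after node $a$. With $l = a = 0$ this encodes a
  partition together with an increasing map, and the empty list when the right factor is trivial.\<close>

definition placements :: "nat \<Rightarrow> nat \<Rightarrow> nat \<Rightarrow> nat \<Rightarrow> (nat \<times> nat) list set" where
  "placements l r a b = {ps. sorted_wrt (\<lambda>p q. fst p < fst q \<and> snd p < snd q) ps \<and>
     set ps \<subseteq> {l<..r} \<times> {a<..b} \<and> last (a # map snd ps) = b}"

lemma finite_placements: "finite (placements l r a b)"
proof (rule finite_subset)
  show "placements l r a b \<subseteq> {ps. set ps \<subseteq> {l<..r} \<times> {a<..b} \<and> distinct ps}"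
  proof -
    have "distinct ps" if "sorted_wrt (\<lambda>p q. fst p < fst q \<and> snd p < snd q) ps" for ps :: "(nat \<times> nat) list"
      using that by (induction ps) auto
    then show ?thesis by (auto simp: placements_def)
  qed
qed (simp add: finite_subset_distinct)

text \<open>Since first components increase, the pairs with \<open>fst p \<le> m\<close> form an
  initial segment.\<close>

lemma sorted_wrt_filter_append:
  assumes "sorted_wrt (\<lambda>p q. fst p < fst q \<and> snd p < snd q) ps"
  shows "filter (\<lambda>p. fst p \<le> m) ps @ filter (\<lambda>p. \<not> fst p \<le> m) ps = (ps :: (nat \<times> nat) list)"
  using assms
proof (induction ps)
  case (Cons p ps)
  show ?case
  proof (cases "fst p \<le> m")
    case False
    then have "filter (\<lambda>p. fst p \<le> m) ps = []" "filter (\<lambda>p. \<not> fst p \<le> m) ps = ps"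
      using Cons.prems by (fastforce simp: filter_empty_conv filter_id_conv)+
    with False show ?thesis by simp
  qed (use Cons in auto)
qed simp

lemma snd_le_last:
  assumes "sorted_wrt (\<lambda>p q. fst p < fst q \<and> snd p < snd q) ps" "p \<in> set ps"
  shows "snd p \<le> (last (a # map snd ps) :: nat)"
  using assms
proof (induction ps)
  case (Cons q ps)
  then show ?case
    using last_in_set[of ps] by (cases "ps = []") (auto simp: last_map intro: less_imp_le)
qed simp

lemma placements_append:
  assumes "l \<le> m" "m \<le> r" "a \<le> k" "k \<le> b" "ps \<in> placements l m a k" "qs \<in> placements m r k b"
  shows "ps @ qs \<in> placements l r a b"
proof -
  have "last (a # map snd (ps @ qs)) = b"
    using assms(5,6) by (auto simp: placements_def last_append split: if_splits)
  then show ?thesis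
    using assms by (fastforce simp: placements_def sorted_wrt_append)
qed

text \<open>The list is cut where the nodes of the left factor pass \<open>m\<close>. The break
  point \<open>k\<close> is the end of the last block placed up to \<open>m\<close>, or
  \<open>a\<close> if there is none.\<close>

lemma placements_split:
  fixes m :: nat
  assumes "ps \<in> placements l r a b" "a \<le> b"
  defines "qs \<equiv> filter (\<lambda>p. fst p \<le> m) ps" and "rs \<equiv> filter (\<lambda>p. \<not> fst p \<le> m) ps"
  defines "k \<equiv> last (a # map snd qs)"
  shows "a \<le> k" "k \<le> b" "qs \<in> placements l m a k" "rs \<in> placements m r k b" "qs @ rs = ps"
proof -
  let ?R = "\<lambda>p q :: nat \<times> nat. fst p < fst q \<and> snd p < snd q"
  have s: "sorted_wrt ?R ps" and sub: "set ps \<subseteq> {l<..r} \<times> {a<..b}" and l: "last (a # map snd ps) = b"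
    using assms(1) by (auto simp: placements_def)
  show app: "qs @ rs = ps"
    unfolding qs_def rs_def by (rule sorted_wrt_filter_append[OF s])
  have sq: "sorted_wrt ?R qs" and sr: "sorted_wrt ?R rs" and cross: "\<forall>p\<in>set qs. \<forall>q\<in>set rs. ?R p q"
    using s unfolding app[symmetric] sorted_wrt_append by auto
  have k: "k = a \<and> qs = [] \<or> k \<in> snd ` set qs"
    unfolding k_def by (cases "qs = []") (auto simp: last_map)
  have qsub: "set qs \<subseteq> {l<..m} \<times> {a<..b}" using sub by (auto simp: qs_def)
  then show "a \<le> k" "k \<le> b" using k assms(2) by auto
  show "qs \<in> placements l m a k"
    using qsub sq snd_le_last[OF sq, of _ a, folded k_def] k_def by (fastforce simp: placements_def)
  have "k < snd q" if "q \<in> set rs" for q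
    using k
  proof
    assume "k = a \<and> qs = []"
    then show ?thesis using that sub by (auto simp: rs_def)
  qed (use cross that in blast)
  moreover have "set rs \<subseteq> {m<..r} \<times> {a<..b}" using sub by (auto simp: rs_def)
  moreover have "last (k # map snd rs) = b"
    using l unfolding app[symmetric] k_def by (auto simp: last_append)
  ultimately show "rs \<in> placements m r k b"
    using sr by (fastforce simp: placements_def)
qed

text \<open>The counterpart for placements of cutting \<open>u\<close> into \<open>(u1, u2)\<close>.
  It is a bijection because \<open>k\<close> can be read off from the first part, an empty part
  meaning \<open>k = a\<close>.\<close>

lemma sum_placements_split:
  assumes "l \<le> m" "m \<le> r" "a \<le> b"
  shows "(\<Sum>ps\<in>placements l r a b. \<phi> ps) =
    (\<Sum>k\<in>{a..b}. \<Sum>ps\<in>placements l m a k. \<Sum>qs\<in>placements m r k b. \<phi> (ps @ qs))"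
proof -
  define S where "S = (SIGMA k:{a..b}. placements l m a k \<times> placements m r k b)"
  have "(\<Sum>k\<in>{a..b}. \<Sum>ps\<in>placements l m a k. \<Sum>qs\<in>placements m r k b. \<phi> (ps @ qs)) =
      (\<Sum>(k, ps, qs)\<in>S. \<phi> (ps @ qs))"
    by (simp add: S_def sum.Sigma sum.cartesian_product finite_placements)
  also have "\<dots> = (\<Sum>ps\<in>placements l r a b. \<phi> ps)"
  proof (rule sum.reindex_bij_witness[where
        i = "\<lambda>ps. (last (a # map snd (filter (\<lambda>p. fst p \<le> m) ps)),
          filter (\<lambda>p. fst p \<le> m) ps, filter (\<lambda>p. \<not> fst p \<le> m) ps)" and
        j = "\<lambda>(k, ps, qs). ps @ qs"])
    fix x assume "x \<in> S"
    then obtain k ps qs where x: "x = (k, ps, qs)" and k: "a \<le> k" "k \<le> b"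
      and ps: "ps \<in> placements l m a k" and qs: "qs \<in> placements m r k b"
      by (auto simp: S_def)
    have "\<forall>p\<in>set ps. fst p \<le> m" "\<forall>q\<in>set qs. \<not> fst q \<le> m"
      using ps qs by (auto simp: placements_def)
    then have "filter (\<lambda>p. fst p \<le> m) (ps @ qs) = ps" "filter (\<lambda>p. \<not> fst p \<le> m) (ps @ qs) = qs"
      by (simp_all add: filter_empty_conv filter_id_conv)
    moreover have "last (a # map snd ps) = k" using ps by (simp add: placements_def)
    ultimately show "(\<lambda>ps. (last (a # map snd (filter (\<lambda>p. fst p \<le> m) ps)),
          filter (\<lambda>p. fst p \<le> m) ps, filter (\<lambda>p. \<not> fst p \<le> m) ps))
        ((\<lambda>(k, ps, qs). ps @ qs) x) = x"
      unfolding x by (simp only: prod.case)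
    show "(\<lambda>(k, ps, qs). ps @ qs) x \<in> placements l r a b"
      using placements_append[OF assms(1,2) k ps qs] by (simp add: x)
  next
    fix ps assume ps: "ps \<in> placements l r a b"
    note split = placements_split[OF ps assms(3), of m]
    show "(\<lambda>(k, ps, qs). ps @ qs) (last (a # map snd (filter (\<lambda>p. fst p \<le> m) ps)),
          filter (\<lambda>p. fst p \<le> m) ps, filter (\<lambda>p. \<not> fst p \<le> m) ps) = ps"
      using split(5) by simp
    show "(last (a # map snd (filter (\<lambda>p. fst p \<le> m) ps)),
          filter (\<lambda>p. fst p \<le> m) ps, filter (\<lambda>p. \<not> fst p \<le> m) ps) \<in> S"
      unfolding S_def using split(1-4) by (simp del: last.simps)
  qed auto
  finally show ?thesis ..
qed

text \<open>Strict increase allows at most one pair, and its block must then reach \<open>b\<close>;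
  the base case of the product recursion.\<close>

lemma placements_single_slot:
  assumes "a \<le> b"
  shows "placements l (Suc l) a b = {if a = b then [] else [(Suc l, b)]}"
proof -
  have "ps = (if a = b then [] else [(Suc l, b)])" if ps: "ps \<in> placements l (Suc l) a b" for ps
  proof (cases ps)
    case Nil
    then show ?thesis using ps by (simp add: placements_def)
  next
    case (Cons p qs)
    have "qs = []"
      using ps Cons by (cases qs) (auto simp: placements_def)
    then show ?thesis using ps Cons assms by (cases p) (auto simp: placements_def)
  qed
  then show ?thesis using assms by (auto simp: placements_def)
qed

section \<open>Grafting along placements\<close>

fun slot_content :: "(nat \<Rightarrow> nat \<Rightarrow> tree list) \<Rightarrow> nat \<Rightarrow> (nat \<times> nat) list \<Rightarrow> nat \<Rightarrow> tree list" where
  "slot_content B a [] v = []"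
| "slot_content B a ((w, n) # ps) v = (if w = v then B a n else []) @ slot_content B n ps v"

lemma slot_content_append:
  "slot_content B a (ps @ qs) v = slot_content B a ps v @ slot_content B (last (a # map snd ps)) qs v"
  by (induction B a ps v rule: slot_content.induct) auto

lemma slot_content_notin: "v \<notin> fst ` set ps \<Longrightarrow> slot_content B a ps v = []"
  by (induction B a ps v rule: slot_content.induct) auto

lemma graft_list_cong:
  assumes "\<And>i. off < i \<Longrightarrow> i \<le> off + nnodes_list f \<Longrightarrow> g i = h i"
  shows "graft_list g off f = graft_list h off f"
  using assms
proof (induction f arbitrary: off rule: forest_coprod.induct)
  case (2 d c)
  have "graft_list g off d = graft_list h off d"
    by (rule 2(1)) (use 2(3) in auto)
  moreover have "graft_list g (off + Suc (nnodes_list d)) c = graft_list h (off + Suc (nnodes_list d)) c"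
    by (rule 2(2)) (use 2(3) in auto)
  ultimately show ?case using 2(3)[of "off + Suc (nnodes_list d)"] by simp
qed simp

text \<open>There is one slot more than \<open>f\<close> has nodes: the last one is the surrounding
  root, whose content is appended on the right.\<close>

lemma sum_placements_graft:
  fixes u :: "tree list"
  defines "B \<equiv> \<lambda>i j. restr_list {i<..j} 0 u"
  assumes "a \<le> b" "b \<le> nnodes_list u"
  shows "(\<Sum>ps\<in>placements off (off + Suc (nnodes_list f)) a b.
      \<phi> (graft_list (slot_content B a ps) off f @ slot_content B a ps (off + Suc (nnodes_list f)))) =
    (\<Sum>x\<in>#forest_prod f (B a b). \<phi> x)"
  using assms(2,3)
proof (induction f arbitrary: off a b \<phi> rule: forest_coprod.induct)
  case (1 off a b)
  then show ?case by (auto simp: placements_single_slot B_def restr_list_empty)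
next
  case (2 d c)
  \<comment> \<open>\<open>e\<close> numbers the root of the first tree, which is the additional
    slot for \<open>d\<close>; \<open>z\<close> numbers the surrounding root, which is the
    additional slot for \<open>c\<close>.\<close>
  define e where "e = off + Suc (nnodes_list d)"
  define z where "z = e + Suc (nnodes_list c)"
  have z: "off + Suc (nnodes_list (Node d # c)) = z"
    by (simp add: z_def e_def)
  \<comment> \<open>The two halves do not interact: slots up to \<open>e\<close> see only
    \<open>ps\<close>, later ones only \<open>qs\<close>, whose first block starts at the end
    \<open>k\<close> of \<open>ps\<close>.\<close>
  have content: "graft_list (slot_content B a (ps @ qs)) off (Node d # c) @ slot_content B a (ps @ qs) z =
      Node (graft_list (slot_content B a ps) off d @ slot_content B a ps e) #
      (graft_list (slot_content B k qs) e c @ slot_content B k qs z)"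
    if ps: "ps \<in> placements off e a k" and qs: "qs \<in> placements e z k b" for ps qs k
  proof -
    have "slot_content B a (ps @ qs) v = slot_content B a ps v" if "v \<le> e" for v
    proof -
      have "v \<notin> fst ` set qs" using qs that by (auto simp: placements_def)
      from slot_content_notin[OF this] show ?thesis by (simp only: slot_content_append append_Nil2)
    qed
    moreover have "slot_content B a (ps @ qs) v = slot_content B k qs v" if "e < v" for v
    proof -
      have v: "v \<notin> fst ` set ps" and last: "last (a # map snd ps) = k"
        using ps that by (auto simp: placements_def)
      from slot_content_notin[OF v] show ?thesis by (simp only: slot_content_append last append_Nil)
    qed
    ultimately show ?thesis
      by (auto simp: e_def z_def intro!: graft_list_cong)
  qed
  have "(\<Sum>ps\<in>placements off z a b.
      \<phi> (graft_list (slot_content B a ps) off (Node d # c) @ slot_content B a ps z)) =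
    (\<Sum>k\<in>{a..b}. \<Sum>ps\<in>placements off e a k. \<Sum>qs\<in>placements e z k b.
      \<phi> (Node (graft_list (slot_content B a ps) off d @ slot_content B a ps e) #
        (graft_list (slot_content B k qs) e c @ slot_content B k qs z)))"
  proof -
    have "off \<le> e" "e \<le> z" by (auto simp: e_def z_def)
    from sum_placements_split[OF this 2(3)] show ?thesis
      by (rule trans) (intro sum.cong refl arg_cong[where f = \<phi>] content)
  qed
  also have "\<dots> = (\<Sum>k\<in>{a..b}. \<Sum>ps\<in>placements off e a k. \<Sum>y\<in>#forest_prod c (B k b).
      \<phi> (Node (graft_list (slot_content B a ps) off d @ slot_content B a ps e) # y))"
    using 2(4) by (intro sum.cong refl, subst z_def, subst z_def, subst 2(2)) auto
  also have "\<dots> = (\<Sum>k\<in>{a..b}. \<Sum>x\<in>#forest_prod d (B a k). \<Sum>y\<in>#forest_prod c (B k b). \<phi> (Node x # y))"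
    using 2(4) by (intro sum.cong refl, subst e_def, subst e_def, subst 2(1)) auto
  \<comment> \<open>The sum over break points \<open>k\<close> becomes the sum over cuts of the
    block by \<open>forest_coprod_restr_list\<close>.\<close>
  also have "\<dots> = (\<Sum>(u1, u2)\<in>#forest_coprod (B a b). \<Sum>x\<in>#forest_prod d u1. \<Sum>y\<in>#forest_prod c u2. \<phi> (Node x # y))"
    using 2(3,4) by (simp add: B_def forest_coprod_restr_list multiset.map_comp comp_def sum_unfold_sum_mset)
  finally show ?case
    unfolding z by (simp only: sum_forest_prod_Cons)
qed

text \<open>Reconciles blocks given by list indices with the recursive passing of the previous
  endpoint; \<open>a\<close> is general because it changes in the induction.\<close>

lemma slot_content_blocks:
  assumes "length vs = length ns"
  shows "slot_content B a (zip vs ns) v =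
    concat (map (\<lambda>(b, w). if w = v then b else [])
      (zip (map (\<lambda>i. B ((a # ns) ! i) (ns ! i)) [0..<length ns]) vs))"
  using assms
proof (induction vs ns arbitrary: a rule: list_induct2)
  case (Cons w vs n ns)
  have "map (\<lambda>i. B ((a # n # ns) ! i) ((n # ns) ! i)) [0..<length (n # ns)] =
      B a n # map (\<lambda>i. B ((n # ns) ! i) (ns ! i)) [0..<length ns]"
    by (simp add: upt_conv_Cons map_Suc_upt[symmetric] del: upt_Suc)
  with Cons show ?case by (simp del: upt_Suc)
qed simp

lemma hash_eq:
  assumes "length vs = length ns"
  shows "hash t (blocks u ns) vs =
    (let g = slot_content (\<lambda>i j. restr_list {i<..j} 0 (children u)) 0 (zip vs ns)
     in Node (graft_list g 0 (children t) @ g (nnodes t)))"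
proof -
  have "(\<lambda>v. concat (map (\<lambda>(b, w). if w = v then children b else []) (zip (blocks u ns) vs))) =
      slot_content (\<lambda>i j. restr_list {i<..j} 0 (children u)) 0 (zip vs ns)"
    by (simp add: slot_content_blocks[OF assms] blocks_def restr_int_eq zip_map1 comp_def
        case_prod_unfold children_def fun_eq_iff cong: if_cong)
  then show ?thesis
    by (cases t) (simp add: hash_def Let_def children_def)
qed

text \<open>Zipping is a bijection, since \<open>0 < n\<close> rules out the empty placement. For
  \<open>n = 0\<close> there is no partition but one placement, the empty one, which is why the
  product treats degree 0 separately.\<close>

lemma sum_partitions:
  assumes "0 < n"
  shows "(\<Sum>ns\<in>partitions n. \<Sum>vs\<in>incr_maps (length ns) t. \<phi> (zip vs ns)) =
    (\<Sum>ps\<in>placements 0 (nnodes t) 0 n. \<phi> ps)"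
proof -
  have sorted: "sorted_wrt (\<lambda>p q. fst p < fst q \<and> snd p < snd q) ps \<longleftrightarrow>
      sorted_wrt (<) (map fst ps) \<and> sorted_wrt (<) (map snd ps)" for ps :: "(nat \<times> nat) list"
    by (induction ps) auto
  have fin: "finite {xs. sorted_wrt (<) xs \<and> set xs \<subseteq> {1..m}}" for m :: nat
    by (rule finite_subset[OF _ finite_subset_distinct[of "{1..m}"]])
      (auto simp: strict_sorted_iff)
  have "finite (partitions n)"
    by (rule finite_subset[OF _ fin[of n]]) (auto simp: partitions_def)
  moreover have "finite (incr_maps k t)" for k
    by (rule finite_subset[OF _ fin[of "nnodes t"]]) (auto simp: incr_maps_def)
  ultimately have "(\<Sum>ns\<in>partitions n. \<Sum>vs\<in>incr_maps (length ns) t. \<phi> (zip vs ns)) =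
      (\<Sum>(ns, vs)\<in>(SIGMA ns:partitions n. incr_maps (length ns) t). \<phi> (zip vs ns))"
    by (simp add: sum.Sigma)
  also have "\<dots> = (\<Sum>ps\<in>placements 0 (nnodes t) 0 n. \<phi> ps)"
  proof (rule sum.reindex_bij_witness[where i = "\<lambda>ps. (map snd ps, map fst ps)" and j = "\<lambda>(ns, vs). zip vs ns"])
    fix x assume x: "x \<in> (SIGMA ns:partitions n. incr_maps (length ns) t)"
    then obtain ns vs where [simp]: "x = (ns, vs)" "length vs = length ns" by (auto simp: incr_maps_def)
    show "(\<lambda>ps. (map snd ps, map fst ps)) ((\<lambda>(ns, vs). zip vs ns) x) = x" by simp
    show "(\<lambda>(ns, vs). zip vs ns) x \<in> placements 0 (nnodes t) 0 n"
    proof -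
      have "set vs \<subseteq> {0<..nnodes t}" "set ns \<subseteq> {0<..n}"
        using x by (auto simp: partitions_def incr_maps_def)
      then have "set (zip vs ns) \<subseteq> {0<..nnodes t} \<times> {0<..n}"
        using set_zip_leftD[of _ _ vs ns] set_zip_rightD[of _ _ vs ns] by fast
      then show ?thesis
        using x \<open>length vs = length ns\<close>
        by (cases "vs = []") (auto simp: placements_def sorted partitions_def incr_maps_def)
    qed
  next
    fix ps assume ps: "ps \<in> placements 0 (nnodes t) 0 n"
    then have "ps \<noteq> []" using assms by (auto simp: placements_def)
    with ps show "(map snd ps, map fst ps) \<in> (SIGMA ns:partitions n. incr_maps (length ns) t)"
      by (fastforce simp: placements_def sorted partitions_def incr_maps_def)
  qed (auto simp: zip_map_fst_snd)
  finally show ?thesis .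
qed

subsection \<open>The Hopf algebra of trees\<close>

definition tree_mset_prod :: "tree \<Rightarrow> tree \<Rightarrow> tree multiset" where
  "tree_mset_prod t u = image_mset Node (forest_prod (children t) (children u))"

definition tree_mset_coprod :: "tree \<Rightarrow> (tree \<times> tree) multiset" where
  "tree_mset_coprod t = image_mset (map_prod Node Node) (forest_coprod (children t))"

lemma children_Node [simp]: "children (Node f) = f" "Node (children t) = t"
  by (auto simp: children_def split: tree.split)

lemma tree_prod_eq: "tree_prod t u = msum (tree_mset_prod t u)"
proof (cases "deg u = 0")
  case True
  have "children u = []"
  proof (cases "children u")
    case (Cons c cs)
    then show ?thesis using True by (cases c) (simp add: deg_eq)
  qed
  then show ?thesis using True
    by (simp add: tree_prod_def tree_mset_prod_def forest_prod_Nil)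
next
  case False
  let ?g = "slot_content (\<lambda>i j. restr_list {i<..j} 0 (children u)) 0"
  have "tree_prod t u = (\<Sum>ns\<in>partitions (deg u). \<Sum>vs\<in>incr_maps (length ns) t.
      basis (Node (graft_list (?g (zip vs ns)) 0 (children t) @ ?g (zip vs ns) (nnodes t))))"
    using False by (auto simp: tree_prod_def hash_eq Let_def incr_maps_def intro!: sum.cong)
  also have "\<dots> = (\<Sum>ps\<in>placements 0 (nnodes t) 0 (deg u).
      basis (Node (graft_list (?g ps) 0 (children t) @ ?g ps (nnodes t))))"
    using False by (intro sum_partitions) simp
  also have "\<dots> = (\<Sum>x\<in>#forest_prod (children t) (children u). basis (Node x))"
    using sum_placements_graft[where a = 0 and off = 0 and b = "deg u" and u = "children u"
        and f = "children t" and \<phi> = "\<lambda>x. basis (Node x)"]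
    by (simp add: deg_eq nnodes_eq restr_list_all)
  finally show ?thesis
    by (simp add: tree_mset_prod_def msum_def multiset.map_comp comp_def)
qed

lemma tree_coprod_eq: "tree_coprod t = msum (tree_mset_coprod t)"
proof -
  have "forest_coprod (children t) = image_mset (\<lambda>k. (restr_list {0<..k} 0 (children t),
      restr_list {k<..deg t} 0 (children t))) (mset_set {0..deg t})"
    using forest_coprod_restr_list[of 0 0 "deg t" "children t"] by (simp add: deg_eq restr_list_all)
  then show ?thesis
    using restr_int_eq[of t 0]
    by (simp add: tree_coprod_def tree_mset_coprod_def msum_def multiset.map_comp comp_def
        restr_int_eq sum_unfold_sum_mset)
qed

lemma sum_tree_mset_prod:
  "(\<Sum>x\<in>#tree_mset_prod t u. \<phi> x) = (\<Sum>x\<in>#forest_prod (children t) (children u). \<phi> (Node x))"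
  by (simp add: tree_mset_prod_def multiset.map_comp comp_def)

lemma sum_tree_mset_coprod:
  "(\<Sum>(a, b)\<in>#tree_mset_coprod t. \<phi> a b) = (\<Sum>(a, b)\<in>#forest_coprod (children t). \<phi> (Node a) (Node b))"
  by (simp add: tree_mset_coprod_def multiset.map_comp comp_def case_prod_unfold)

text \<open>Writing multisets as sums of singletons makes the locale axioms instances of the forest
  identities, with \<open>\<phi>\<close> taking multisets as values.\<close>

lemma image_mset_eq_sum: "image_mset f A = (\<Sum>x\<in>#A. {#f x#})"
  by (induction A) auto

lemma image_mset_pair_eq_sum: "image_mset (\<lambda>(a, b). f a b) A = (\<Sum>(a, b)\<in>#A. {#f a b#})"
  by (induction A) auto

lemma tree_mset_coprod_eq_sum:
  "tree_mset_coprod t = (\<Sum>(a, b)\<in>#forest_coprod (children t). {#(Node a, Node b)#})"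
  by (simp add: tree_mset_coprod_def map_prod_def flip: image_mset_pair_eq_sum)

interpretation trees: multiset_bialgebra tree_mset_prod tree_mset_coprod odot deg
proof
  show "(\<Sum>x\<in>#tree_mset_prod a b. tree_mset_prod x c) = (\<Sum>y\<in>#tree_mset_prod b c. tree_mset_prod a y)" for a b c
    unfolding sum_tree_mset_prod unfolding tree_mset_prod_def image_mset_eq_sum[of Node] children_Node
    by (rule forest_prod_assoc)
  show "tree_mset_prod odot a = {#a#}" "tree_mset_prod a odot = {#a#}" for a
    by (simp_all add: tree_mset_prod_def odot_def forest_prod_Nil)
  show "(\<Sum>(a, b)\<in>#tree_mset_coprod x. image_mset (\<lambda>(a1, a2). (a1, a2, b)) (tree_mset_coprod a)) =
      (\<Sum>(a, b)\<in>#tree_mset_coprod x. image_mset (\<lambda>(b1, b2). (a, b1, b2)) (tree_mset_coprod b))" for x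
    unfolding image_mset_pair_eq_sum[of "\<lambda>a1 a2. (a1, a2, b)" for b]
      image_mset_pair_eq_sum[of "\<lambda>b1 b2. (a, b1, b2)" for a] sum_tree_mset_coprod children_Node
    by (rule forest_coprod_coassoc)
  show "filter_mset (\<lambda>p. fst p = odot) (tree_mset_coprod x) = {#(odot, x)#}"
    "filter_mset (\<lambda>p. snd p = odot) (tree_mset_coprod x) = {#(x, odot)#}" for x
    by (simp_all add: tree_mset_coprod_def filter_mset_image_mset odot_def
        forest_coprod_counit_left forest_coprod_counit_right)
  show "(\<Sum>x\<in>#tree_mset_prod a b. tree_mset_coprod x) =
      (\<Sum>(a1, a2)\<in>#tree_mset_coprod a. \<Sum>(b1, b2)\<in>#tree_mset_coprod b. \<Sum>x\<in>#tree_mset_prod a1 b1.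
        image_mset (Pair x) (tree_mset_prod a2 b2))" for a b
    unfolding image_mset_eq_sum[of "Pair _"] sum_tree_mset_coprod sum_tree_mset_prod
    unfolding tree_mset_coprod_eq_sum children_Node
    by (rule forest_coprod_forest_prod)
  show "tree_mset_coprod odot = {#(odot, odot)#}"
    by (simp add: tree_mset_coprod_def odot_def)
  show "deg a = 0 \<longleftrightarrow> a = odot" for a
  proof (cases "children a")
    case (Cons c cs)
    then have "deg a \<noteq> 0" by (cases c) (simp add: deg_eq)
    moreover have "a \<noteq> odot" using Cons by (auto simp: odot_def)
    ultimately show ?thesis by simp
  next
    case Nil
    then show ?thesis using children_Node(2)[of a] by (simp add: deg_eq odot_def)
  qed
  show "deg x = deg a + deg b" if "x \<in># tree_mset_prod a b" for x a b
    using that by (auto simp: tree_mset_prod_def deg_eq nnodes_list_forest_prod)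
  show "deg a + deg b = deg x" if "(a, b) \<in># tree_mset_coprod x" for a b x
    using that by (auto simp: tree_mset_coprod_def deg_eq nnodes_list_forest_coprod)
qed

theorem theorem3p7:
  shows "hopf_algebra (tree_prod :: tree \<Rightarrow> tree \<Rightarrow> (tree \<Rightarrow>\<^sub>0 'k::field))
           (basis odot) tree_coprod tree_counit
         \<and> (\<forall>u v :: tree. tcoprod (tprod (basis u) (basis v) :: tree \<Rightarrow>\<^sub>0 'k)
                = tprod2 (tcoprod (basis u)) (tcoprod (basis v)))"
proof -
  have prod: "tree_prod = (\<lambda>t u. msum (tree_mset_prod t u) :: tree \<Rightarrow>\<^sub>0 'k)"
    and coprod: "tree_coprod = (\<lambda>t. msum (tree_mset_coprod t) :: tree \<times> tree \<Rightarrow>\<^sub>0 'k)"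
    and counit: "tree_counit = (\<lambda>t. if t = odot then 1 else (0 :: 'k))"
    by (simp_all add: fun_eq_iff tree_prod_eq tree_coprod_eq tree_counit_def trees.weight_0)
  show ?thesis
    using trees.hopf_algebra_msum trees.comul_mul
    unfolding tprod_def tcoprod_def tprod2_def prod coprod counit trees.mul_def trees.comul_def
    by blast
qed

end
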